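(* Let $m$ and $s$ be positive integers with $s<m$, let $S=\{\mathbf u\in\mathbb R^m:\|\mathbf u_+\|_0\le s\}$, and let $\mathbf z\in\mathbb R^m$. Then $$\mathbb P_S(\mathbf z)=\Big\{(0;\mathbf z_{\overline T}):\ T\in\mathbb T(\mathbf z;s)\Big\},$$ where $(0;\mathbf z_{\overline T})$ denotes the vector $\mathbf u\in\mathbb R^m$ with $u_i=0$ for $i\in T$ and $u_i=z_i$ for $i\in\overline T$.
   Context: $\mathbb N_m=\{1,\dots,m\}$; for $T\subseteq\mathbb N_m$, $\overline T=\mathbb N_m\setminus T$. For $\mathbf u\in\mathbb R^m$, $\mathbf u_+=(\max\{u_1,0\},\dots,\max\{u_m,0\})^\top$ and $\|\cdot\|_0$ counts nonzero entries, so $\|\mathbf u_+\|_0$ is the number of positive entries of $\mathbf u$. $\|\cdot\|$ is the Euclidean norm. For a nonempty closed set $\Omega\subseteq\mathbb R^m$, $\mathbb P_\Omega(\mathbf z)=\operatorname{argmin}\{\|\mathbf z-\mathbf u\|:\mathbf u\in\Omega\}$ is the (possibly multi-element) set of all minimizers. For $\mathbf z\in\mathbb R^m$ put $\Gamma_+=\{i:z_i>0\}$, $\Gamma_0=\{i:z_i=0\}$. $\mathbb T(\mathbf z;s)$ is the collection of all index sets $T=(\Gamma_+\setminus\Gamma_s)\cup\Gamma_0$, where $\Gamma_s$ ranges over all subsets $\Gamma_s\subseteq\Gamma_+$ with $|\Gamma_s|=\min\{s,|\Gamma_+|\}$ such that $z_i\ge z_j\ge 0$ for all $i\in\Gamma_s$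 and all $j\in T$ (i.e. $\Gamma_s$ collects indices of $\min\{s,|\Gamma_+|\}$ largest positive entries, ties broken arbitrarily). *)

theory Defs
  imports "HOL-Analysis.Analysis"
begin

text \<open>
  Vectors in \<open>m\<close>-dimensional Euclidean space are of type \<^typ>\<open>real ^ 'm\<close>: the finite type \<open>'m\<close>
  is the index set \<open>{1, \<dots>, m}\<close>, \<open>CARD('m)\<close> is the dimension \<open>m\<close>, and \<^const>\<open>norm\<close> is the
  Euclidean norm.
\<close>

definition pos_part :: "real ^ 'm \<Rightarrow> real ^ 'm"
  where "pos_part u = (\<chi> i. max (u $ i) 0)"

definition l0_norm :: "real ^ 'm \<Rightarrow> nat"
  where "l0_norm u = card {i. u $ i \<noteq> 0}"

definition step_set :: "nat \<Rightarrow> (real ^ 'm) set"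
  where "step_set s = {u. l0_norm (pos_part u) \<le> s}"

text \<open>
  The full set of minimizers, which need not be a singleton when \<open>\<Omega>\<close> is not convex
  (unlike \<^const>\<open>closest_point\<close>, which selects one of them).
\<close>

definition proj_set :: "(real ^ 'm) set \<Rightarrow> real ^ 'm \<Rightarrow> (real ^ 'm) set"
  where "proj_set \<Omega> z = {u. is_arg_min (\<lambda>u. norm (z - u)) (\<lambda>u. u \<in> \<Omega>) u}"

definition Gamma_pos :: "real ^ 'm \<Rightarrow> 'm set"
  where "Gamma_pos z = {i. z $ i > 0}"

definition Gamma_zero :: "real ^ 'm \<Rightarrow> 'm set"
  where "Gamma_zero z = {i. z $ i = 0}"

definition T_sets :: "real ^ 'm \<Rightarrow> nat \<Rightarrow> 'm set set"
  where "T_sets z s =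
    {T. \<exists>G. G \<subseteq> Gamma_pos z \<and> card G = min s (card (Gamma_pos z)) \<and>
            T = (Gamma_pos z - G) \<union> Gamma_zero z \<and>
            (\<forall>i\<in>G. \<forall>j\<in>T. z $ i \<ge> z $ j \<and> z $ j \<ge> 0)}"

text \<open>The vector \<open>(0; z\<^sub>C)\<close> where \<open>C\<close> is the complement of \<open>T\<close>.\<close>

definition zero_on :: "'m set \<Rightarrow> real ^ 'm \<Rightarrow> real ^ 'm"
  where "zero_on T z = (\<chi> i. if i \<in> T then 0 else z $ i)"

end

theory Submission
  imports Defs
begin

text \<open>
  Membership in the step set only restricts \<^emph>\<open>which\<close> coordinates may be positive, so the
  projection splits into a continuous and a combinatorial problem. Let \<open>P\<close> be the set of positive
  coordinates of \<open>z\<close>, let \<open>u\<close> be feasible and let \<open>B\<close> be the set of those \<open>i\<close> in \<open>P\<close> with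
  \<open>u\<^sub>i > 0\<close>. On \<open>P - B\<close> we have \<open>u\<^sub>i \<le> 0 < z\<^sub>i\<close>, so the coordinate \<open>i\<close> costs at least \<open>z\<^sub>i\<^sup>2\<close>,
  with equality only for \<open>u\<^sub>i = 0\<close>; elsewhere the cost is at least \<open>0\<close>, with equality only for
  \<open>u\<^sub>i = z\<^sub>i\<close>. Hence the vector that vanishes on \<open>P - B\<close> and agrees with \<open>z\<close> elsewhere is the
  unique best competitor with this choice of \<open>B\<close> (lemmas \<open>norm_diff_ge\<close> and
  \<open>norm_diff_minimal_eq\<close>), and its squared distance to \<open>z\<close> is the sum of \<open>z\<^sub>i\<^sup>2\<close> over \<open>P - B\<close>.

  What remains is to choose \<open>B \<subseteq> P\<close> with at most \<open>s\<close> elements and with the largest sum of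
  \<open>z\<^sub>i\<^sup>2\<close>. Since the weights are positive, an exchange argument shows that the optimal \<open>B\<close> are
  exactly the sets of \<open>min s |P|\<close> largest entries (lemma \<open>sum_maximal_iff_top\<close>). Coordinates where
  \<open>z\<close> is zero can be added to the zeroed set without changing the vector.
\<close>

section \<open>Subsets of bounded size with maximal weight\<close>

text \<open>
  After the common elements are cancelled, the largest weight left in \<open>A\<close> separates the two
  differences: no weight on \<open>A - B\<close> exceeds it and no weight on \<open>B - A\<close> falls below it, and
  \<open>B - A\<close> has at least as many elements.
\<close>

lemma sum_le_of_dominating:
  fixes f :: "'a \<Rightarrow> real"
  assumes fin: "finite A" "finite B" and card: "card A \<le> card B"
    and dom: "\<And>i j. i \<in> B \<Longrightarrow> j \<in> A - B \<Longrightarrow> f j \<le> f i"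
    and nonneg: "\<And>i. i \<in> B \<Longrightarrow> 0 \<le> f i"
  shows "sum f A \<le> sum f B"
proof -
  have diff: "sum f (A - B) \<le> sum f (B - A)"
  proof (cases "A - B = {}")
    case True
    show ?thesis
      unfolding True by (auto intro!: sum_nonneg nonneg)
  next
    case False
    define c where "c = Max (f ` (A - B))"
    have c_in: "c \<in> f ` (A - B)"
      unfolding c_def using fin False by (intro Max_in) auto
    have upper: "f j \<le> c" if "j \<in> A - B" for j
      unfolding c_def using fin that by (intro Max_ge) auto
    have lower: "c \<le> f i" if "i \<in> B" for i
      using c_in dom that by auto
    have card_diff: "card (A - B) \<le> card (B - A)"
      using card fin by (simp add: card_le_sym_Diff)
    \<comment> \<open>A negative \<open>c\<close> would reverse the comparison of the two multiples of \<open>c\<close>, so both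
      bounds use \<open>max c 0\<close>; the weights on \<open>B\<close> stay above it because they are nonnegative.\<close>
    have "sum f (A - B) \<le> of_nat (card (A - B)) * max c 0"
      using upper by (intro sum_bounded_above) (auto simp: le_max_iff_disj)
    also have "\<dots> \<le> of_nat (card (B - A)) * max c 0"
      using card_diff by (intro mult_right_mono) auto
    also have "\<dots> \<le> sum f (B - A)"
      using lower nonneg by (intro sum_bounded_below) auto
    finally show ?thesis .
  qed
  have "sum f A = sum f (A \<inter> B) + sum f (A - B)"
    using fin(1) by (rule sum.Int_Diff)
  also have "\<dots> \<le> sum f (B \<inter> A) + sum f (B - A)"
    using diff by (simp add: Int_commute)
  also have "\<dots> = sum f B"
    using fin(2) by (rule sum.Int_Diff[symmetric])
  finally show ?thesis .
qed

text \<open>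
  A maximal set admits no improvement by inserting an element, which forces its size, and none by
  swapping a smaller member for a larger non-member, which forces it to hold the largest weights.
  That these local conditions suffice for global optimality is the preceding lemma.
\<close>

lemma sum_maximal_iff_top:
  fixes f :: "'a \<Rightarrow> real"
  assumes fin: "finite P" and pos: "\<And>i. i \<in> P \<Longrightarrow> 0 < f i"
    and B: "B \<subseteq> P" "card B \<le> s"
  shows "(\<forall>A. A \<subseteq> P \<longrightarrow> card A \<le> s \<longrightarrow> sum f A \<le> sum f B) \<longleftrightarrow>
    card B = min s (card P) \<and> (\<forall>i\<in>B. \<forall>j\<in>P - B. f j \<le> f i)"
    (is "?maximal \<longleftrightarrow> ?size \<and> ?top")
proof -
  have finB: "finite B"
    using B(1) fin by (rule finite_subset)
  have card_le: "card A \<le> card P" if "A \<subseteq> P" for A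
    using fin that by (rule card_mono)
  show ?thesis
  proof (intro iffI conjI ballI)
    assume max: ?maximal
    show ?size
    proof (rule ccontr)
      assume "card B \<noteq> min s (card P)"
      with B card_le[OF B(1)] have less: "card B < s" "card B < card P" by auto
      then have "B \<noteq> P" by auto
      with B obtain j where j: "j \<in> P - B" by auto
      have "sum f (insert j B) \<le> sum f B"
        using max[rule_format, of "insert j B"] j B less finB by simp
      with j finB pos[of j] show False by auto
    qed
  next
    assume max: ?maximal
    fix i j assume i: "i \<in> B" and j: "j \<in> P - B"
    let ?A = "insert j (B - {i})"
    have "card ?A = card B"
      using i j finB by (simp add: card_Suc_Diff1 del: card_Diff_insert card_Diff_singleton)
    then have "sum f ?A \<le> sum f B"
      using max[rule_format, of ?A] i j B by auto
    then show "f j \<le> f i"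
      using i j finB by (simp add: sum_diff1)
  next
    assume top: "?size \<and> ?top"
    show ?maximal
    proof (intro allI impI)
      fix A assume A: "A \<subseteq> P" "card A \<le> s"
      show "sum f A \<le> sum f B"
      proof (rule sum_le_of_dominating)
        show "finite A" using A(1) fin by (rule finite_subset)
        show "card A \<le> card B" using top A card_le[OF A(1)] by simp
        show "f j \<le> f i" if "i \<in> B" "j \<in> A - B" for i j
          using top A that by auto
        show "0 \<le> f i" if "i \<in> B" for i
          using pos B that by (auto intro: less_imp_le)
      qed (rule finB)
    qed
  qed
qed

section \<open>The step set and distances to vectors with zeroed coordinates\<close>

lemma step_set_iff: "u \<in> step_set s \<longleftrightarrow> card (Gamma_pos u) \<le> s"
proof -
  have "{i. pos_part u $ i \<noteq> 0} = Gamma_pos u"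
    by (auto simp: pos_part_def Gamma_pos_def max_def)
  then show ?thesis
    by (simp add: step_set_def l0_norm_def)
qed

lemma proj_set_iff:
  "u \<in> proj_set S z \<longleftrightarrow> u \<in> S \<and> (\<forall>v\<in>S. (norm (z - u))\<^sup>2 \<le> (norm (z - v))\<^sup>2)"
  by (auto simp: proj_set_def is_arg_min_linorder)

lemma norm_diff_power2: "(norm (z - u))\<^sup>2 = (\<Sum>i\<in>UNIV. (z $ i - u $ i)\<^sup>2)"
  for z u :: "real ^ 'm"
  unfolding power2_norm_eq_inner inner_vec_def by (simp add: power2_eq_square)

lemma zero_on_Un_Gamma_zero: "zero_on (T \<union> Gamma_zero z) z = zero_on T z"
  by (auto simp: zero_on_def Gamma_zero_def vec_eq_iff)

lemma Gamma_pos_zero_on: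
  assumes "B \<subseteq> Gamma_pos z"
  shows "Gamma_pos (zero_on (Gamma_pos z - B) z) = B"
  using assms by (auto simp: Gamma_pos_def zero_on_def)

lemma norm_diff_zero_on:
  "(norm (z - zero_on T z))\<^sup>2 = (\<Sum>i\<in>T. (z $ i)\<^sup>2)"
proof -
  have "(norm (z - zero_on T z))\<^sup>2 = (\<Sum>i\<in>UNIV. if i \<in> T then (z $ i)\<^sup>2 else 0)"
    unfolding norm_diff_power2 by (intro sum.cong) (auto simp: zero_on_def)
  also have "\<dots> = (\<Sum>i\<in>T. (z $ i)\<^sup>2)"
    by (simp add: sum.If_cases)
  finally show ?thesis .
qed

text \<open>
  The weight that is kept is the complement of the weight that is lost, which turns the minimal
  distance into the maximal sum of the combinatorial problem.
\<close>

lemma norm_diff_zero_on_le_iff: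
  assumes "A \<subseteq> Gamma_pos z" "B \<subseteq> Gamma_pos z"
  shows "(norm (z - zero_on (Gamma_pos z - B) z))\<^sup>2 \<le> (norm (z - zero_on (Gamma_pos z - A) z))\<^sup>2
    \<longleftrightarrow> (\<Sum>i\<in>A. (z $ i)\<^sup>2) \<le> (\<Sum>i\<in>B. (z $ i)\<^sup>2)"
  using assms by (simp add: norm_diff_zero_on sum_diff)

text \<open>
  A coordinate that is positive in \<open>z\<close> but not in \<open>u\<close> separates \<open>u\<^sub>i\<close> from \<open>z\<^sub>i\<close> by the
  point \<open>0\<close>, so moving \<open>u\<^sub>i\<close> to \<open>0\<close> brings it strictly closer to \<open>z\<^sub>i\<close> unless it is there already.
\<close>

lemma coordinate_diff_ge:
  fixes z u :: "real ^ 'm"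
  defines "v \<equiv> zero_on (Gamma_pos z - Gamma_pos u) z"
  shows "(z $ i - v $ i)\<^sup>2 \<le> (z $ i - u $ i)\<^sup>2"
    and "(z $ i - v $ i)\<^sup>2 = (z $ i - u $ i)\<^sup>2 \<Longrightarrow> u $ i = v $ i"
proof -
  show "(z $ i - v $ i)\<^sup>2 \<le> (z $ i - u $ i)\<^sup>2"
    by (auto simp: v_def zero_on_def Gamma_pos_def intro!: power_mono)
  show "u $ i = v $ i" if "(z $ i - v $ i)\<^sup>2 = (z $ i - u $ i)\<^sup>2"
    using that
    by (auto simp: v_def zero_on_def Gamma_pos_def power2_eq_iff split: if_splits)
qed

lemma norm_diff_ge:
  "(norm (z - zero_on (Gamma_pos z - Gamma_pos u) z))\<^sup>2 \<le> (norm (z - u))\<^sup>2"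
  unfolding norm_diff_power2 by (intro sum_mono coordinate_diff_ge)

lemma norm_diff_minimal_eq:
  assumes "(norm (z - u))\<^sup>2 \<le> (norm (z - zero_on (Gamma_pos z - Gamma_pos u) z))\<^sup>2"
  shows "u = zero_on (Gamma_pos z - Gamma_pos u) z"
proof -
  let ?v = "zero_on (Gamma_pos z - Gamma_pos u) z"
  have "(\<Sum>i\<in>UNIV. (z $ i - ?v $ i)\<^sup>2) = (\<Sum>i\<in>UNIV. (z $ i - u $ i)\<^sup>2)"
    using assms norm_diff_ge[of z u] by (simp add: norm_diff_power2)
  then have "(z $ i - ?v $ i)\<^sup>2 = (z $ i - u $ i)\<^sup>2" for i
    by (rule sum_mono_inv) (auto intro: coordinate_diff_ge)
  then show ?thesis
    unfolding vec_eq_iff by (intro allI coordinate_diff_ge(2))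
qed

section \<open>The projection onto the step set\<close>

text \<open>
  Zeroing all positive coordinates of \<open>z\<close> outside \<open>B\<close> is projecting exactly when \<open>B\<close> wins against
  every other admissible choice: a feasible \<open>u\<close> is never closer to \<open>z\<close> than the zeroed vector that
  keeps those positive coordinates of \<open>z\<close> that are also positive in \<open>u\<close>.
\<close>

lemma zero_on_in_proj_set_iff:
  assumes B: "B \<subseteq> Gamma_pos z" "card B \<le> s"
  shows "zero_on (Gamma_pos z - B) z \<in> proj_set (step_set s) z \<longleftrightarrow>
    card B = min s (card (Gamma_pos z)) \<and> (\<forall>i\<in>B. \<forall>j\<in>Gamma_pos z - B. z $ j \<le> z $ i)"
    (is "?v B \<in> _ \<longleftrightarrow> _")
proof -
  let ?P = "Gamma_pos z"
  have v_in: "?v A \<in> step_set s" if "A \<subseteq> ?P" "card A \<le> s" for A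
    using that by (simp add: step_set_iff Gamma_pos_zero_on)
  have "?v B \<in> proj_set (step_set s) z \<longleftrightarrow>
      (\<forall>A. A \<subseteq> ?P \<longrightarrow> card A \<le> s \<longrightarrow> (norm (z - ?v B))\<^sup>2 \<le> (norm (z - ?v A))\<^sup>2)"
    (is "_ \<longleftrightarrow> ?best")
  proof
    assume "?v B \<in> proj_set (step_set s) z"
    then show ?best
      using v_in by (auto simp: proj_set_iff)
  next
    assume best: ?best
    have "(norm (z - ?v B))\<^sup>2 \<le> (norm (z - u))\<^sup>2" if u: "u \<in> step_set s" for u
    proof -
      have "card (?P \<inter> Gamma_pos u) \<le> card (Gamma_pos u)"
        by (intro card_mono) auto
      then have "(norm (z - ?v B))\<^sup>2 \<le> (norm (z - ?v (?P \<inter> Gamma_pos u)))\<^sup>2"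
        using best u by (auto simp: step_set_iff)
      also have "?v (?P \<inter> Gamma_pos u) = ?v (Gamma_pos u)"
        by (simp add: Diff_Int)
      also have "(norm (z - ?v (Gamma_pos u)))\<^sup>2 \<le> (norm (z - u))\<^sup>2"
        by (rule norm_diff_ge)
      finally show ?thesis .
    qed
    then show "?v B \<in> proj_set (step_set s) z"
      using v_in[OF B] by (simp add: proj_set_iff)
  qed
  also have "\<dots> \<longleftrightarrow> (\<forall>A. A \<subseteq> ?P \<longrightarrow> card A \<le> s \<longrightarrow> (\<Sum>i\<in>A. (z $ i)\<^sup>2) \<le> (\<Sum>i\<in>B. (z $ i)\<^sup>2))"
    using norm_diff_zero_on_le_iff[OF _ B(1)] by blast
  also have "\<dots> \<longleftrightarrow> card B = min s (card ?P) \<and> (\<forall>i\<in>B. \<forall>j\<in>?P - B. (z $ j)\<^sup>2 \<le> (z $ i)\<^sup>2)"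
    using B by (intro sum_maximal_iff_top) (auto simp: Gamma_pos_def)
  also have "(\<forall>i\<in>B. \<forall>j\<in>?P - B. (z $ j)\<^sup>2 \<le> (z $ i)\<^sup>2) \<longleftrightarrow> (\<forall>i\<in>B. \<forall>j\<in>?P - B. z $ j \<le> z $ i)"
  proof (intro ball_cong refl)
    fix i j assume "i \<in> B" "j \<in> ?P - B"
    with B have "0 \<le> z $ i" "0 \<le> z $ j" by (auto simp: Gamma_pos_def)
    then show "(z $ j)\<^sup>2 \<le> (z $ i)\<^sup>2 \<longleftrightarrow> z $ j \<le> z $ i"
      by simp
  qed
  finally show ?thesis .
qed

text \<open>
  The inequalities that involve a zero coordinate of \<open>z\<close> hold automatically, because the kept
  entries are positive, and so do the sign conditions, because \<open>T\<close> contains no negative entry.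
\<close>

lemma T_sets_iff:
  "T \<in> T_sets z s \<longleftrightarrow>
    (\<exists>B. B \<subseteq> Gamma_pos z \<and> card B = min s (card (Gamma_pos z)) \<and>
      (\<forall>i\<in>B. \<forall>j\<in>Gamma_pos z - B. z $ j \<le> z $ i) \<and> T = (Gamma_pos z - B) \<union> Gamma_zero z)"
proof -
  have "(\<forall>i\<in>B. \<forall>j\<in>(Gamma_pos z - B) \<union> Gamma_zero z. z $ j \<le> z $ i \<and> 0 \<le> z $ j) \<longleftrightarrow>
      (\<forall>i\<in>B. \<forall>j\<in>Gamma_pos z - B. z $ j \<le> z $ i)" if "B \<subseteq> Gamma_pos z" for B
    using that by (fastforce simp: Gamma_pos_def Gamma_zero_def)
  then show ?thesis
    unfolding T_sets_def by blast
qed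

theorem proposition2p1:
  fixes z :: "real ^ 'm" and s :: nat
  assumes "0 < s" and "s < CARD('m)"
  shows "proj_set (step_set s) z = {zero_on T z | T. T \<in> T_sets z s}"
proof (intro equalityI subsetI)
  fix u assume u: "u \<in> proj_set (step_set s) z"
  let ?P = "Gamma_pos z"
  define B where "B = ?P \<inter> Gamma_pos u"
  have zeroed: "zero_on (?P - Gamma_pos u) z = zero_on (?P - B) z"
    by (simp add: B_def Diff_Int)
  have "card B \<le> card (Gamma_pos u)"
    unfolding B_def by (intro card_mono) auto
  then have B: "B \<subseteq> ?P" "card B \<le> s"
    using u by (auto simp: B_def proj_set_iff step_set_iff)
  then have "zero_on (?P - B) z \<in> step_set s"
    by (simp add: step_set_iff Gamma_pos_zero_on)
  then have "u = zero_on (?P - B) z"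
    using u norm_diff_minimal_eq[of z u] unfolding zeroed proj_set_iff by blast
  moreover from this u have "(?P - B) \<union> Gamma_zero z \<in> T_sets z s"
    using zero_on_in_proj_set_iff[OF B] B by (auto simp: T_sets_iff)
  ultimately show "u \<in> {zero_on T z | T. T \<in> T_sets z s}"
    using zero_on_Un_Gamma_zero[of "?P - B" z] by (metis (mono_tags, lifting) mem_Collect_eq)
next
  fix u assume "u \<in> {zero_on T z | T. T \<in> T_sets z s}"
  then obtain B where
    B: "B \<subseteq> Gamma_pos z" "card B = min s (card (Gamma_pos z))"
      "\<forall>i\<in>B. \<forall>j\<in>Gamma_pos z - B. z $ j \<le> z $ i"
    and u: "u = zero_on (Gamma_pos z - B) z"
    by (auto simp: T_sets_iff zero_on_Un_Gamma_zero)
  show "u \<in> proj_set (step_set s) z"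
    unfolding u using B by (subst zero_on_in_proj_set_iff) auto
qed

end
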